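(* Let $(X,d)$ be a complete metric space and let $\mathcal S=(X,(\phi_j)_{j=1}^L)$ be an IFS on $X$ consisting of Banach contractions, with attractor $A_{\mathcal S}$. Let $\varepsilon>0$, let $\hat X$ be a proper $\varepsilon$-net of $X$, let $r:X\to\hat X$ be an $\varepsilon$-projection, and let $\hat{\mathcal S}:=(\hat X,(\hat\phi_j)_{j=1}^L)$, where $\hat\phi_j:=(r\circ\phi_j)_{|\hat X}$. Then for any $K\in\mathcal K^*(\hat X)$ and every $n\in\mathbb N$, $$h\big(F_{\hat{\mathcal S}}^{\,n}(K),A_{\mathcal S}\big)\le\frac{5\varepsilon}{1-\alpha_{\mathcal S}}+\alpha_{\mathcal S}^{\,n}\,h(K,A_{\mathcal S}).$$ In particular, there is $n_0\in\mathbb N$ such that for every $n\ge n_0$, $F_{\hat{\mathcal S}}^{\,n}(K)$ is an attractor of $\mathcal S$ with resolution $\frac{6\varepsilon}{1-\alpha_{\mathcal S}}$.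
   Context: A Banach contraction is a selfmap $\phi$ of a metric space with Lipschitz constant $\operatorname{Lip}(\phi)<1$. $\mathcal K^*(X)$ is the family of all nonempty compact subsets of $X$, with the Hausdorff metric $h$. An iterated function system (IFS) $\mathcal S=(X,(\phi_j)_{j=1}^L)$ is a finite family of continuous selfmaps $\phi_1,\dots,\phi_L$ of $X$; its Hutchinson operator $F_{\mathcal S}:\mathcal K^*(X)\to\mathcal K^*(X)$ is $F_{\mathcal S}(K)=\bigcup_{j=1}^L\phi_j(K)$. The attractor of $\mathcal S$ is the unique $A_{\mathcal S}\in\mathcal K^*(X)$ with $F_{\mathcal S}(A_{\mathcal S})=A_{\mathcal S}$ and such that $F_{\mathcal S}^k(K)\to A_{\mathcal S}$ in $h$ for every $K\in\mathcal K^*(X)$; it exists when $X$ is (nonempty and) complete and all $\phi_j$ are Banach contractions. $\alpha_{\mathcal S}:=\max\{\operatorname{Lip}(\phi_j):j=1,\dots,L\}$. For $\delta>0$, a set $A_\delta\in\mathcal K^*(X)$ is an attractor of $\mathcal S$ with resolution $\delta$ if $h(A_\delta,A_{\mathcal S})\le\delta$. A subset $\hat X\subset X$ is an $\varepsilon$-net of $X$ if for every $x\in X$ there is $y\in\hat X$ with $d(x,y)\le\varepsilon$; it is proper if $D\cap\hat X$ is finite for every bounded $D\subset X$. (Then $\mathcal K^*(\hat X)$ is the family of nonempty finite subsets of $\hat X$, viewed as a subfamily of $\mathcal K^*(X)$.) An $\varepsilon$-projection is a map $r:X\to\hat X$ with $r(x)=x$ for $x\in\hat X$ and $d(x,r(x))\le\varepsilon$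 for all $x\in X$. *)

theory Defs
  imports "HOL-Analysis.Analysis"
begin

text \<open>
  A metric space is given by a carrier \<open>X\<close> inside a type of class \<open>metric_space\<close>, so that an IFS on
  the space and an IFS on one of its subsets are instances of the same notion. An IFS
  \<open>(X, (\<phi>\<^sub>j)\<^sub>1\<^sub>\<le>\<^sub>j\<^sub>\<le>\<^sub>L)\<close> is given by \<open>X\<close>, \<open>L\<close> and \<open>\<phi>\<close>; only the values of \<open>\<phi> j\<close> on \<open>X\<close> for
  \<open>1 \<le> j \<le> L\<close> are relevant.
\<close>

definition kstar :: "'a::metric_space set \<Rightarrow> 'a set set" where
  "kstar X = {K. K \<subseteq> X \<and> K \<noteq> {} \<and> compact K}"

text \<open>Only used for nonempty bounded sets, where both suprema are finite.\<close>

definition hausdorff_dist :: "'a::metric_space set \<Rightarrow> 'a set \<Rightarrow> real" where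
  "hausdorff_dist A B = max (SUP x\<in>A. infdist x B) (SUP y\<in>B. infdist y A)"

text \<open>The least Lipschitz constant; meaningful only if \<open>f\<close> is Lipschitz on \<open>X\<close>.\<close>

definition Lip :: "'a::metric_space set \<Rightarrow> ('a \<Rightarrow> 'a) \<Rightarrow> real" where
  "Lip X f = Inf {C. C-lipschitz_on X f}"

definition banach_contraction :: "'a::metric_space set \<Rightarrow> ('a \<Rightarrow> 'a) \<Rightarrow> bool" where
  "banach_contraction X f \<longleftrightarrow> f \<in> X \<rightarrow> X \<and> (\<exists>C. C-lipschitz_on X f) \<and> Lip X f < 1"

definition ifs :: "'a::metric_space set \<Rightarrow> nat \<Rightarrow> (nat \<Rightarrow> 'a \<Rightarrow> 'a) \<Rightarrow> bool" where
  "ifs X L \<phi> \<longleftrightarrow> 1 \<le> L \<and> (\<forall>j\<in>{1..L}. \<phi> j \<in> X \<rightarrow> X \<and> continuous_on X (\<phi> j))"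

definition hutchinson :: "nat \<Rightarrow> (nat \<Rightarrow> 'a \<Rightarrow> 'a) \<Rightarrow> 'a set \<Rightarrow> 'a set" where
  "hutchinson L \<phi> K = (\<Union>j\<in>{1..L}. \<phi> j ` K)"

definition attractor :: "'a::metric_space set \<Rightarrow> nat \<Rightarrow> (nat \<Rightarrow> 'a \<Rightarrow> 'a) \<Rightarrow> 'a set" where
  "attractor X L \<phi> = (THE A. A \<in> kstar X \<and> hutchinson L \<phi> A = A \<and>
     (\<forall>K\<in>kstar X. (\<lambda>k. hausdorff_dist ((hutchinson L \<phi> ^^ k) K) A) \<longlonglongrightarrow> 0))"

definition ifs_alpha :: "'a::metric_space set \<Rightarrow> nat \<Rightarrow> (nat \<Rightarrow> 'a \<Rightarrow> 'a) \<Rightarrow> real" where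
  "ifs_alpha X L \<phi> = Max ((\<lambda>j. Lip X (\<phi> j)) ` {1..L})"

definition attractor_with_resolution ::
    "'a::metric_space set \<Rightarrow> nat \<Rightarrow> (nat \<Rightarrow> 'a \<Rightarrow> 'a) \<Rightarrow> real \<Rightarrow> 'a set \<Rightarrow> bool" where
  "attractor_with_resolution X L \<phi> \<delta> B \<longleftrightarrow>
     B \<in> kstar X \<and> hausdorff_dist B (attractor X L \<phi>) \<le> \<delta>"

definition eps_net :: "'a::metric_space set \<Rightarrow> real \<Rightarrow> 'a set \<Rightarrow> bool" where
  "eps_net X \<epsilon> Y \<longleftrightarrow> Y \<subseteq> X \<and> (\<forall>x\<in>X. \<exists>y\<in>Y. dist x y \<le> \<epsilon>)"

definition proper_in :: "'a::metric_space set \<Rightarrow> 'a set \<Rightarrow> bool" where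
  "proper_in X Y \<longleftrightarrow> (\<forall>D\<subseteq>X. bounded D \<longrightarrow> finite (D \<inter> Y))"

definition eps_projection :: "'a::metric_space set \<Rightarrow> real \<Rightarrow> 'a set \<Rightarrow> ('a \<Rightarrow> 'a) \<Rightarrow> bool" where
  "eps_projection X \<epsilon> Y r \<longleftrightarrow>
     r \<in> X \<rightarrow> Y \<and> (\<forall>x\<in>Y. r x = x) \<and> (\<forall>x\<in>X. dist x (r x) \<le> \<epsilon>)"

definition discretized_maps ::
    "'a set \<Rightarrow> ('a \<Rightarrow> 'a) \<Rightarrow> (nat \<Rightarrow> 'a \<Rightarrow> 'a) \<Rightarrow> nat \<Rightarrow> 'a \<Rightarrow> 'a" where
  "discretized_maps Y r \<phi> j = restrict (r \<circ> \<phi> j) Y"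

end

theory Submission
  imports Defs
begin

text \<open>
  The Hutchinson operator \<open>F\<close> of an IFS of Lipschitz constant \<open>a < 1\<close> contracts the Hausdorff
  distance by \<open>a\<close>, and replacing the maps by their discretizations moves the image of a compact
  set by at most \<open>\<epsilon>\<close>. Hence the distances \<open>u n\<close> of the discretized iterates to the attractor
  satisfy \<open>u (n + 1) \<le> \<epsilon> + a * u n\<close>, which gives \<open>u n \<le> \<epsilon> / (1 - a) + a ^ n * u 0\<close>.

  The attractor is obtained as the closure of the orbit under \<open>F\<close> of the singleton of a fixed point
  of one of the maps: this orbit increases, so its union \<open>U\<close> satisfies \<open>F U = U\<close>, and it is totally
  bounded because the contraction property keeps it within \<open>O(a ^ n)\<close> of its \<open>n\<close>-th, finite, term.
\<close>

section \<open>The Hausdorff distance on compact sets\<close>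

lemma bdd_above_infdist_image:
  fixes P Q :: "'a::metric_space set"
  assumes "compact P"
  shows "bdd_above ((\<lambda>x. infdist x Q) ` P)"
  by (intro bounded_imp_bdd_above compact_imp_bounded compact_continuous_image assms
      continuous_on_infdist continuous_on_id)

text \<open>Compactness keeps both suprema finite and nonemptiness makes them meaningful, so
  bounding them amounts to bounding every value.\<close>

lemma hausdorff_dist_le_iff:
  assumes "P \<in> kstar X" "Q \<in> kstar X"
  shows "hausdorff_dist P Q \<le> \<rho> \<longleftrightarrow>
    (\<forall>p\<in>P. infdist p Q \<le> \<rho>) \<and> (\<forall>q\<in>Q. infdist q P \<le> \<rho>)"
  using assms
  by (auto simp: hausdorff_dist_def kstar_def cSUP_le_iff bdd_above_infdist_image)

lemma hausdorff_dist_commute: "hausdorff_dist P Q = hausdorff_dist Q P"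
  by (simp add: hausdorff_dist_def max.commute)

lemma hausdorff_dist_leI:
  assumes "P \<in> kstar X" "Q \<in> kstar X"
    and "\<And>p. p \<in> P \<Longrightarrow> \<exists>q\<in>Q. dist p q \<le> \<rho>" "\<And>q. q \<in> Q \<Longrightarrow> \<exists>p\<in>P. dist q p \<le> \<rho>"
  shows "hausdorff_dist P Q \<le> \<rho>"
  unfolding hausdorff_dist_le_iff[OF assms(1,2)]
  using assms(3,4) by (meson infdist_le2)

text \<open>Compactness of \<open>Q\<close> provides a nearest point, so the bound holds for an
  actual partner of \<open>p\<close> without any additional slack. Together with
  \<open>hausdorff_dist_leI\<close> this reduces the estimates below to matching points.\<close>

lemma hausdorff_distE:
  assumes "P \<in> kstar X" "Q \<in> kstar X" "p \<in> P"
  obtains q where "q \<in> Q" "dist p q \<le> hausdorff_dist P Q"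
proof -
  have Q: "compact Q" "Q \<noteq> {}"
    using assms(2) by (auto simp: kstar_def)
  obtain q where q: "q \<in> Q" "\<forall>y\<in>Q. dist p q \<le> dist p y"
    using continuous_attains_inf[OF Q continuous_on_dist[OF continuous_on_const continuous_on_id]]
    by blast
  have "dist p q \<le> infdist p Q"
    using q Q by (auto simp: infdist_notempty intro!: cINF_greatest)
  also have "\<dots> \<le> hausdorff_dist P Q"
    using hausdorff_dist_le_iff[OF assms(1,2), of "hausdorff_dist P Q"] assms(3) by simp
  finally show thesis
    using q that by blast
qed

lemma hausdorff_dist_nonneg:
  assumes "P \<in> kstar X" "Q \<in> kstar X"
  shows "0 \<le> hausdorff_dist P Q"
proof -
  obtain p where "p \<in> P"
    using assms(1) by (auto simp: kstar_def)
  then obtain q where "dist p q \<le> hausdorff_dist P Q"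
    using hausdorff_distE[OF assms] by metis
  then show ?thesis
    using zero_le_dist order_trans by blast
qed

lemma hausdorff_dist_triangle:
  assumes "P \<in> kstar X" "Q \<in> kstar X" "R \<in> kstar X"
  shows "hausdorff_dist P R \<le> hausdorff_dist P Q + hausdorff_dist Q R"
proof -
  \<comment> \<open>The one-sided estimate is stated for arbitrary outer sets, so that exchanging
    their roles and using symmetry gives the other side.\<close>
  have *: "\<exists>s\<in>S. dist p s \<le> hausdorff_dist P Q + hausdorff_dist Q S"
    if PS: "P \<in> kstar X" "S \<in> kstar X" and "p \<in> P" for P S p
  proof -
    obtain q where q: "q \<in> Q" "dist p q \<le> hausdorff_dist P Q"
      using hausdorff_distE[OF PS(1) assms(2) \<open>p \<in> P\<close>] .
    obtain s where "s \<in> S" "dist q s \<le> hausdorff_dist Q S"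
      using hausdorff_distE[OF assms(2) PS(2) \<open>q \<in> Q\<close>] .
    with q dist_triangle[of p s q] show ?thesis
      by (intro bexI[of _ s]) auto
  qed
  show ?thesis
  proof (rule hausdorff_dist_leI[OF assms(1,3)])
    show "\<exists>q\<in>R. dist p q \<le> hausdorff_dist P Q + hausdorff_dist Q R" if "p \<in> P" for p
      using *[OF assms(1,3) that] .
    show "\<exists>p\<in>P. dist q p \<le> hausdorff_dist P Q + hausdorff_dist Q R" if "q \<in> R" for q
      using *[OF assms(3,1) that]
      by (simp add: hausdorff_dist_commute[of R] hausdorff_dist_commute[of _ P] add.commute)
  qed
qed

lemma hausdorff_dist_le_0_imp_subset:
  assumes "P \<in> kstar X" "Q \<in> kstar X" "hausdorff_dist P Q \<le> 0"
  shows "P \<subseteq> Q"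
proof
  fix p assume "p \<in> P"
  then obtain q where "q \<in> Q" "dist p q \<le> hausdorff_dist P Q"
    using hausdorff_distE[OF assms(1,2)] by blast
  with assms(3) show "p \<in> Q"
    by (metis dist_le_zero_iff order_trans)
qed

lemma hausdorff_dist_le_0_imp_eq:
  assumes "P \<in> kstar X" "Q \<in> kstar X" "hausdorff_dist P Q \<le> 0"
  shows "P = Q"
  using assms hausdorff_dist_le_0_imp_subset hausdorff_dist_commute by (metis subset_antisym)

section \<open>The attractor of a contractive IFS\<close>

text \<open>The value \<open>b / (1 - a)\<close> is the fixed point of the map sending
  \<open>t\<close> to \<open>b + a * t\<close>, which makes the bound reproduce itself. It serves
  both for the orbits of \<open>F\<close> and for the discretized iterates.\<close>

lemma affine_recurrence_bound:
  fixes u :: "nat \<Rightarrow> real"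
  assumes "0 \<le> a" "a < 1" and step: "\<And>n. u (Suc n) \<le> b + a * u n" and "0 \<le> b"
  shows "u n \<le> b / (1 - a) + a ^ n * u 0"
proof (induction n)
  case 0
  then show ?case using assms by simp
next
  case (Suc n)
  have "u (Suc n) \<le> b + a * (b / (1 - a) + a ^ n * u 0)"
    using step[of n] mult_left_mono[OF Suc.IH \<open>0 \<le> a\<close>] by linarith
  also have "\<dots> = b / (1 - a) + a ^ Suc n * u 0"
    using \<open>a < 1\<close> by (simp add: field_simps)
  finally show ?case .
qed

text \<open>A compact set is bounded, so properness applies with \<open>K\<close> itself as the
  bounded set.\<close>

lemma finite_kstar_proper:
  assumes "proper_in X Y" "Y \<subseteq> X" "K \<in> kstar Y"
  shows "finite K"
proof -
  have "K \<subseteq> Y" "bounded K"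
    using assms(3) by (auto simp: kstar_def compact_imp_bounded)
  then show ?thesis
    using assms(1,2) unfolding proper_in_def by (metis inf.absorb1 order_trans)
qed

text \<open>Here \<open>a\<close> is any common Lipschitz constant below 1. The infimum in
  \<open>Lip\<close> and the maximum in \<open>ifs_alpha\<close> enter only when the locale is
  instantiated.\<close>

locale contractive_ifs =
  fixes X :: "'a::metric_space set" and L :: nat and \<phi> :: "nat \<Rightarrow> 'a \<Rightarrow> 'a" and a :: real
  assumes complete: "complete X" and nonempty: "X \<noteq> {}" and L: "1 \<le> L" and a: "a < 1"
    and maps: "\<And>j. j \<in> {1..L} \<Longrightarrow> \<phi> j \<in> X \<rightarrow> X"
    and lipschitz: "\<And>j. j \<in> {1..L} \<Longrightarrow> a-lipschitz_on X (\<phi> j)"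
begin

abbreviation F where "F \<equiv> hutchinson L \<phi>"

lemma a_nonneg: "0 \<le> a"
  using lipschitz[of 1] L lipschitz_on_nonneg by auto

lemma hutchinson_subset: "P \<subseteq> X \<Longrightarrow> F P \<subseteq> X"
  using maps by (auto simp: hutchinson_def Pi_iff)

lemma hutchinson_kstar:
  assumes "P \<in> kstar X"
  shows "F P \<in> kstar X"
proof -
  have P: "P \<subseteq> X" "P \<noteq> {}" "compact P"
    using assms by (auto simp: kstar_def)
  have "compact (F P)"
    unfolding hutchinson_def
    by (intro compact_UN compact_continuous_image P continuous_on_subset[OF _ P(1)]
        lipschitz_on_continuous_on[OF lipschitz]) auto
  moreover have "F P \<noteq> {}"
    using P L by (auto simp: hutchinson_def)
  ultimately show ?thesis
    using hutchinson_subset P(1) by (auto simp: kstar_def)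
qed

lemma funpow_hutchinson_kstar: "P \<in> kstar X \<Longrightarrow> (F ^^ n) P \<in> kstar X"
  by (induction n) (auto intro: hutchinson_kstar)

text \<open>A point \<open>\<phi> j x\<close> of one image is matched with \<open>\<phi> j y\<close>
  for the same \<open>j\<close>, where \<open>y\<close> is a partner of \<open>x\<close>. The union
  over \<open>j\<close> therefore costs nothing beyond the factor \<open>a\<close>.\<close>

lemma hausdorff_dist_hutchinson_le:
  assumes "P \<in> kstar X" "Q \<in> kstar X"
  shows "hausdorff_dist (F P) (F Q) \<le> a * hausdorff_dist P Q"
proof -
  have *: "\<exists>q\<in>F Q. dist p q \<le> a * hausdorff_dist P Q"
    if PQ: "P \<in> kstar X" "Q \<in> kstar X" and "p \<in> F P" for P Q p
  proof -
    obtain j x where j: "j \<in> {1..L}" "x \<in> P" "p = \<phi> j x"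
      using \<open>p \<in> F P\<close> by (auto simp: hutchinson_def)
    obtain y where y: "y \<in> Q" "dist x y \<le> hausdorff_dist P Q"
      using hausdorff_distE[OF PQ \<open>x \<in> P\<close>] .
    have "dist (\<phi> j x) (\<phi> j y) \<le> a * dist x y"
      using lipschitz_onD[OF lipschitz[OF j(1)]] j(2) y(1) PQ by (auto simp: kstar_def)
    also have "\<dots> \<le> a * hausdorff_dist P Q"
      using y(2) a_nonneg by (rule mult_left_mono)
    finally show ?thesis
      using j y by (auto simp: hutchinson_def)
  qed
  show ?thesis
  proof (rule hausdorff_dist_leI[OF hutchinson_kstar[OF assms(1)] hutchinson_kstar[OF assms(2)]])
    show "\<exists>q\<in>F Q. dist p q \<le> a * hausdorff_dist P Q" if "p \<in> F P" for p
      using *[OF assms that] .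
    show "\<exists>p\<in>F P. dist q p \<le> a * hausdorff_dist P Q" if "q \<in> F Q" for q
      using *[OF assms(2,1) that] by (simp add: hausdorff_dist_commute)
  qed
qed

lemma hausdorff_dist_funpow_hutchinson_le:
  assumes "P \<in> kstar X" "Q \<in> kstar X"
  shows "hausdorff_dist ((F ^^ n) P) ((F ^^ n) Q) \<le> a ^ n * hausdorff_dist P Q"
proof (induction n)
  case (Suc n)
  have "hausdorff_dist ((F ^^ Suc n) P) ((F ^^ Suc n) Q)
      \<le> a * hausdorff_dist ((F ^^ n) P) ((F ^^ n) Q)"
    using hausdorff_dist_hutchinson_le funpow_hutchinson_kstar assms by simp
  also have "\<dots> \<le> a * (a ^ n * hausdorff_dist P Q)"
    using Suc.IH a_nonneg by (rule mult_left_mono)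
  finally show ?case by (simp add: mult.assoc)
qed simp

text \<open>Passing through \<open>F P\<close> and contracting the remaining distance gives an
  affine recurrence. Its initial term appears as \<open>hausdorff_dist P P\<close>.\<close>

lemma hausdorff_dist_orbit_bounded:
  assumes "P \<in> kstar X"
  shows "hausdorff_dist P ((F ^^ n) P)
    \<le> hausdorff_dist P (F P) / (1 - a) + a ^ n * hausdorff_dist P P"
proof -
  have "hausdorff_dist P ((F ^^ Suc n) P) \<le> hausdorff_dist P (F P) + a * hausdorff_dist P ((F ^^ n) P)"
    for n
    using hausdorff_dist_triangle[OF assms, of "F P" "(F ^^ Suc n) P"]
      hausdorff_dist_hutchinson_le[OF assms funpow_hutchinson_kstar[OF assms, of n]]
      hutchinson_kstar[OF assms] funpow_hutchinson_kstar[OF assms, of "Suc n"]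
    by simp
  from affine_recurrence_bound[where u = "\<lambda>n. hausdorff_dist P ((F ^^ n) P)", OF a_nonneg a this]
  show ?thesis
    using hausdorff_dist_nonneg[OF assms hutchinson_kstar[OF assms]] by simp
qed

lemma totally_bounded_orbit:
  assumes K: "K \<in> kstar X" "finite K" "K \<subseteq> F K" and "e > 0"
  obtains n where "finite ((F ^^ n) K)" "(\<Union>m. (F ^^ m) K) \<subseteq> (\<Union>x\<in>(F ^^ n) K. ball x e)"
proof -
  \<comment> \<open>\<open>R\<close> bounds the distance from \<open>K\<close> to all its iterates
    at once, so the \<open>n\<close> chosen below does not depend on \<open>m\<close>.\<close>
  define R where "R = hausdorff_dist K (F K) / (1 - a) + hausdorff_dist K K"
  have KK: "0 \<le> hausdorff_dist K K"
    using hausdorff_dist_nonneg K(1) by blast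
  have R: "hausdorff_dist K ((F ^^ m) K) \<le> R" for m
  proof -
    have "a ^ m * hausdorff_dist K K \<le> 1 * hausdorff_dist K K"
      using KK a_nonneg a by (intro mult_right_mono power_le_one) auto
    then show ?thesis
      using hausdorff_dist_orbit_bounded[OF K(1), of m] by (simp add: R_def)
  qed
  have "(\<lambda>n. a ^ n * R) \<longlonglongrightarrow> 0 * R"
    using a_nonneg a by (intro tendsto_mult LIMSEQ_realpow_zero tendsto_const)
  then have "\<forall>\<^sub>F n in sequentially. a ^ n * R < e"
    using \<open>e > 0\<close> by (intro order_tendstoD(2)) auto
  then obtain n where n: "a ^ n * R < e"
    by (auto simp: eventually_sequentially)
  have mono: "incseq (\<lambda>m. (F ^^ m) K)"
  proof (rule incseq_SucI)
    show "(F ^^ m) K \<subseteq> (F ^^ Suc m) K" for m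
      by (induction m) (use K(3) in \<open>force simp: hutchinson_def\<close>)+
  qed
  have "finite ((F ^^ n) K)"
    by (induction n) (auto simp: hutchinson_def K(2))
  moreover have "(F ^^ m) K \<subseteq> (\<Union>x\<in>(F ^^ n) K. ball x e)" for m
  proof
    fix p assume "p \<in> (F ^^ m) K"
    \<comment> \<open>Raising the index from \<open>m\<close> to \<open>n + m\<close> allows
      \<open>F ^^ n\<close> to be split off from both sets, which yields the factor
      \<open>a ^ n\<close>.\<close>
    then have p: "p \<in> (F ^^ (n + m)) K"
      using incseqD[OF mono, of m "n + m"] by auto
    obtain q where q: "q \<in> (F ^^ n) K"
        "dist p q \<le> hausdorff_dist ((F ^^ (n + m)) K) ((F ^^ n) K)"
      using hausdorff_distE[OF funpow_hutchinson_kstar[OF K(1)] funpow_hutchinson_kstar[OF K(1)] p] .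
    note q(2)
    also have "hausdorff_dist ((F ^^ (n + m)) K) ((F ^^ n) K) \<le> a ^ n * hausdorff_dist ((F ^^ m) K) K"
      using hausdorff_dist_funpow_hutchinson_le[OF funpow_hutchinson_kstar[OF K(1)] K(1)]
      by (simp add: funpow_add)
    also have "\<dots> \<le> a ^ n * R"
      using R[of m] a_nonneg by (simp add: hausdorff_dist_commute mult_left_mono)
    finally show "p \<in> (\<Union>x\<in>(F ^^ n) K. ball x e)"
      using n q(1) by (force simp: dist_commute)
  qed
  ultimately show thesis
    using that by blast
qed

lemma fixed_compact_set_exists:
  obtains A where "A \<in> kstar X" "F A = A"
proof -
  have one: "1 \<in> {1..L}"
    using L by simp
  \<comment> \<open>A fixed point of \<open>\<phi> 1\<close> gives
    \<open>{x} \<subseteq> F {x}\<close>, the hypothesis that makes the orbit of \<open>{x}\<close>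
    increase.\<close>
  obtain x where x: "x \<in> X" "\<phi> 1 x = x"
    using Banach_fix[OF complete nonempty a_nonneg a, of "\<phi> 1"] maps[OF one]
      lipschitz_onD[OF lipschitz[OF one]] by auto
  have K: "{x} \<in> kstar X" "finite {x}" "{x} \<subseteq> F {x}"
    using x one by (force simp: kstar_def hutchinson_def)+
  define U where "U = (\<Union>m. (F ^^ m) {x})"
  define A where "A = closure U"
  have closed: "closed X"
    using complete by (rule complete_imp_closed)
  have UX: "U \<subseteq> X"
    using funpow_hutchinson_kstar[OF K(1)] by (auto simp: U_def kstar_def)
  have AX: "A \<subseteq> X"
    unfolding A_def using UX closed by (rule closure_minimal)
  have "x \<in> U"
    unfolding U_def by (rule UN_I[of 0]) auto
  then have "A \<noteq> {}"
    by (auto simp: A_def)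
  have "\<exists>k. finite k \<and> A \<subseteq> (\<Union>y\<in>k. ball y e)" if e: "e > 0" for e
  proof -
    \<comment> \<open>Half the radius leaves room for the closure: finitely many closed balls of
      radius \<open>e / 2\<close> form a closed set containing \<open>U\<close>, hence
      \<open>A\<close>, and they lie in the open balls of radius \<open>e\<close>.\<close>
    from e have "e / 2 > 0" by simp
    then obtain n where n: "finite ((F ^^ n) {x})" "U \<subseteq> (\<Union>y\<in>(F ^^ n) {x}. ball y (e / 2))"
      using totally_bounded_orbit[OF K] unfolding U_def by blast
    have "A \<subseteq> (\<Union>y\<in>(F ^^ n) {x}. cball y (e / 2))"
      unfolding A_def
      using n by (intro closure_minimal closed_UN) (auto intro: less_imp_le dest!: subsetD)
    also have "\<dots> \<subseteq> (\<Union>y\<in>(F ^^ n) {x}. ball y e)"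
      using e by (intro UN_mono) (auto simp: cball_def ball_def)
    finally show ?thesis
      using n(1) by blast
  qed
  moreover have "complete A"
    using complete_closed_subset[OF _ AX complete] by (simp add: A_def)
  ultimately have "compact A"
    by (simp add: compact_eq_totally_bounded)
  with AX \<open>A \<noteq> {}\<close> have A: "A \<in> kstar X"
    by (simp add: kstar_def)
  have FU: "F U = U"
  proof
    show "F U \<subseteq> U"
    proof
      fix y assume "y \<in> F U"
      then obtain m where "y \<in> (F ^^ Suc m) {x}"
        by (auto simp: U_def hutchinson_def)
      then show "y \<in> U"
        unfolding U_def by (rule UN_I[OF UNIV_I])
    qed
    \<comment> \<open>Only the term \<open>m = 0\<close> has no predecessor in the orbit; it is
      covered because \<open>x\<close> is fixed by \<open>\<phi> 1\<close>.\<close>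
    have "(F ^^ m) {x} \<subseteq> F U" for m
    proof (cases m)
      case 0
      then show ?thesis using \<open>x \<in> U\<close> K(3) by (auto simp: hutchinson_def)
    next
      case (Suc k)
      then show ?thesis by (auto simp: U_def hutchinson_def)
    qed
    then show "U \<subseteq> F U"
      unfolding U_def by blast
  qed
  have "F A = A"
  proof
    \<comment> \<open>Continuity carries the invariance of \<open>U\<close> over to its closure.
      Conversely, \<open>F A\<close> is compact, hence closed, and contains
      \<open>F U = U\<close>.\<close>
    have "\<phi> j ` A \<subseteq> A" if "j \<in> {1..L}" for j
      unfolding A_def
    proof (rule image_closure_subset)
      show "continuous_on (closure U) (\<phi> j)"
        using AX lipschitz_on_continuous_on[OF lipschitz[OF that]]
        by (auto simp: A_def intro: continuous_on_subset)
      have "\<phi> j ` U \<subseteq> F U"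
        using that by (auto simp: hutchinson_def)
      then show "\<phi> j ` U \<subseteq> closure U"
        using FU closure_subset[of U] by auto
    qed simp
    then show "F A \<subseteq> A"
      unfolding hutchinson_def by (rule UN_least)
    have "F U \<subseteq> F A"
      unfolding hutchinson_def A_def by (intro UN_mono image_mono closure_subset order_refl)
    then have "U \<subseteq> F A"
      by (simp only: FU)
    moreover have "closed (F A)"
      using hutchinson_kstar[OF A] by (auto simp: kstar_def compact_imp_closed)
    ultimately show "A \<subseteq> F A"
      unfolding A_def by (rule closure_minimal)
  qed
  with A show thesis
    using that by blast
qed

text \<open>This resolves the definite description: any compact fixed set attracts every orbit, by
  contraction, and only one set can do so.\<close>

lemma attractor_eq:
  assumes A: "A \<in> kstar X" "F A = A"
  shows "attractor X L \<phi> = A"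
  unfolding attractor_def
proof (rule the_equality)
  have FA: "(F ^^ n) A = A" for n
    using A(2) by (induction n) auto
  have "(\<lambda>n. hausdorff_dist ((F ^^ n) K) A) \<longlonglongrightarrow> 0" if K: "K \<in> kstar X" for K
  proof (rule tendsto_sandwich)
    show "\<forall>\<^sub>F n in sequentially. hausdorff_dist ((F ^^ n) K) A \<le> a ^ n * hausdorff_dist K A"
      using hausdorff_dist_funpow_hutchinson_le[OF K A(1)] by (simp add: FA)
    show "\<forall>\<^sub>F n in sequentially. 0 \<le> hausdorff_dist ((F ^^ n) K) A"
      using hausdorff_dist_nonneg[OF funpow_hutchinson_kstar[OF K] A(1)] by simp
    have "(\<lambda>n. a ^ n * hausdorff_dist K A) \<longlonglongrightarrow> 0 * hausdorff_dist K A"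
      using a_nonneg a by (intro tendsto_mult LIMSEQ_realpow_zero tendsto_const)
    then show "(\<lambda>n. a ^ n * hausdorff_dist K A) \<longlonglongrightarrow> 0" by simp
  qed simp
  with A show "A \<in> kstar X \<and> F A = A \<and>
      (\<forall>K\<in>kstar X. (\<lambda>k. hausdorff_dist ((F ^^ k) K) A) \<longlonglongrightarrow> 0)"
    by blast
  fix B
  assume B: "B \<in> kstar X \<and> F B = B \<and>
      (\<forall>K\<in>kstar X. (\<lambda>k. hausdorff_dist ((F ^^ k) K) B) \<longlonglongrightarrow> 0)"
  \<comment> \<open>The competitor \<open>B\<close> also attracts the orbit of \<open>A\<close>,
    which is constant.\<close>
  then have "(\<lambda>k. hausdorff_dist A B) \<longlonglongrightarrow> 0"
    using A FA by force
  then have "hausdorff_dist A B = 0"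
    by (simp add: LIMSEQ_const_iff)
  then show "B = A"
    using hausdorff_dist_le_0_imp_eq[OF A(1), of B] B by simp
qed

lemma attractor_fixed: "attractor X L \<phi> \<in> kstar X" "F (attractor X L \<phi>) = attractor X L \<phi>"
  using fixed_compact_set_exists attractor_eq by metis+

section \<open>Discretization\<close>

text \<open>Compactness of the image comes from finiteness of \<open>K\<close>; no continuity of
  \<open>r\<close> is assumed.\<close>

lemma hutchinson_discretized_kstar:
  assumes "proper_in X Y" "Y \<subseteq> X" "r \<in> X \<rightarrow> Y" "K \<in> kstar Y"
  shows "hutchinson L (discretized_maps Y r \<phi>) K \<in> kstar Y"
proof -
  have K: "finite K" "K \<subseteq> Y" "K \<noteq> {}"
    using finite_kstar_proper[OF assms(1,2,4)] assms(4) by (auto simp: kstar_def)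
  have "r (\<phi> j x) \<in> Y" if "j \<in> {1..L}" "x \<in> K" for j x
    using maps[OF that(1)] that(2) assms(2,3) K(2) by blast
  moreover have "finite (hutchinson L (discretized_maps Y r \<phi>) K)"
    using K(1) by (simp add: hutchinson_def)
  ultimately show ?thesis
    using K L by (auto simp: kstar_def hutchinson_def discretized_maps_def finite_imp_compact)
qed

text \<open>Points with the same \<open>j\<close> and \<open>x\<close> are matched:
  \<open>\<phi> j x\<close> and its projection \<open>r (\<phi> j x)\<close> are at most
  \<open>\<epsilon>\<close> apart.\<close>

lemma hausdorff_dist_discretized_le:
  assumes "proper_in X Y" "Y \<subseteq> X" "eps_projection X \<epsilon> Y r" "K \<in> kstar Y"
  shows "hausdorff_dist (hutchinson L (discretized_maps Y r \<phi>) K) (F K) \<le> \<epsilon>"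
proof -
  have r: "r \<in> X \<rightarrow> Y" "\<And>x. x \<in> X \<Longrightarrow> dist x (r x) \<le> \<epsilon>"
    using assms(3) by (auto simp: eps_projection_def)
  have K: "K \<subseteq> Y" "K \<in> kstar X"
    using assms(2,4) by (auto simp: kstar_def)
  have near: "dist (\<phi> j x) (discretized_maps Y r \<phi> j x) \<le> \<epsilon>" if "j \<in> {1..L}" "x \<in> K" for j x
  proof -
    have "x \<in> Y" "\<phi> j x \<in> X"
      using that K(1) assms(2) maps[of j] by auto
    then show ?thesis
      using r(2) by (simp add: discretized_maps_def)
  qed
  have "hutchinson L (discretized_maps Y r \<phi>) K \<in> kstar X"
    using hutchinson_discretized_kstar[OF assms(1,2) r(1) assms(4)] assms(2)
    by (auto simp: kstar_def)
  then show ?thesis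
  proof (rule hausdorff_dist_leI[OF _ hutchinson_kstar[OF K(2)]])
    show "\<exists>q\<in>F K. dist p q \<le> \<epsilon>" if "p \<in> hutchinson L (discretized_maps Y r \<phi>) K" for p
      using that near by (fastforce simp: hutchinson_def dist_commute)
    show "\<exists>p\<in>hutchinson L (discretized_maps Y r \<phi>) K. dist q p \<le> \<epsilon>" if "q \<in> F K" for q
      using that near by (fastforce simp: hutchinson_def)
  qed
qed

lemma hausdorff_dist_discretized_iterates:
  assumes "proper_in X Y" "Y \<subseteq> X" "eps_projection X \<epsilon> Y r" "K \<in> kstar Y" "0 \<le> \<epsilon>"
  defines "G \<equiv> hutchinson L (discretized_maps Y r \<phi>)"
  shows "(G ^^ n) K \<in> kstar X"
    and "hausdorff_dist ((G ^^ n) K) (attractor X L \<phi>)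
      \<le> \<epsilon> / (1 - a) + a ^ n * hausdorff_dist K (attractor X L \<phi>)"
proof -
  let ?A = "attractor X L \<phi>"
  have kstar_mono: "P \<in> kstar X" if "P \<in> kstar Y" for P
    using that assms(2) by (auto simp: kstar_def)
  have r: "r \<in> X \<rightarrow> Y"
    using assms(3) by (simp add: eps_projection_def)
  have G: "G P \<in> kstar Y" if "P \<in> kstar Y" for P
    unfolding G_def using hutchinson_discretized_kstar[OF assms(1,2) r that] .
  \<comment> \<open>The induction must stay in \<open>kstar Y\<close>, since \<open>G\<close> is
    controlled only on subsets of the net; the distances are then taken in
    \<open>kstar X\<close>.\<close>
  have iter: "(G ^^ n) K \<in> kstar Y" for n
    by (induction n) (auto intro: G assms(4))
  then show "(G ^^ n) K \<in> kstar X"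
    by (rule kstar_mono)
  have "hausdorff_dist ((G ^^ Suc n) K) ?A \<le> \<epsilon> + a * hausdorff_dist ((G ^^ n) K) ?A" for n
  proof -
    let ?P = "(G ^^ n) K"
    have P: "?P \<in> kstar X" "G ?P \<in> kstar X"
      using iter G kstar_mono by blast+
    \<comment> \<open>The detour through \<open>F ?P\<close> separates the discretization error from
      the contraction towards \<open>?A\<close>, which equals \<open>F ?A\<close>.\<close>
    have "hausdorff_dist (G ?P) ?A \<le> hausdorff_dist (G ?P) (F ?P) + hausdorff_dist (F ?P) (F ?A)"
      using hausdorff_dist_triangle[OF P(2) hutchinson_kstar[OF P(1)] attractor_fixed(1)]
      by (simp add: attractor_fixed(2))
    moreover have "hausdorff_dist (G ?P) (F ?P) \<le> \<epsilon>"
      using hausdorff_dist_discretized_le[OF assms(1-3) iter] by (simp add: G_def)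
    moreover have "hausdorff_dist (F ?P) (F ?A) \<le> a * hausdorff_dist ?P ?A"
      using hausdorff_dist_hutchinson_le[OF P(1) attractor_fixed(1)] .
    ultimately show ?thesis by simp
  qed
  from affine_recurrence_bound[where u = "\<lambda>n. hausdorff_dist ((G ^^ n) K) ?A",
      OF a_nonneg a this \<open>0 \<le> \<epsilon>\<close>, of n]
  show "hausdorff_dist ((G ^^ n) K) ?A \<le> \<epsilon> / (1 - a) + a ^ n * hausdorff_dist K ?A"
    by simp
qed

end

section \<open>Least Lipschitz constants and the final estimate\<close>

lemma lipschitz_on_Lip:
  assumes "C-lipschitz_on X f"
  shows "(Lip X f)-lipschitz_on X f"
proof (rule lipschitz_onI)
  let ?S = "{C. C-lipschitz_on X f}"
  have ne: "?S \<noteq> {}"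
    using assms by auto
  show "0 \<le> Lip X f"
    unfolding Lip_def by (rule cInf_greatest[OF ne]) (auto intro: lipschitz_on_nonneg)
  fix x y
  assume xy: "x \<in> X" "y \<in> X"
  \<comment> \<open>For distinct points the difference quotient is a lower bound of all Lipschitz
    constants, hence of their infimum.\<close>
  show "dist (f x) (f y) \<le> Lip X f * dist x y"
  proof (cases "x = y")
    case False
    then have "dist (f x) (f y) / dist x y \<le> Lip X f"
      unfolding Lip_def using xy
      by (intro cInf_greatest[OF ne]) (auto simp: divide_le_eq dest: lipschitz_onD)
    then show ?thesis
      using False by (simp add: divide_le_eq)
  qed simp
qed

text \<open>A maximum over finitely many maps, at least one by \<open>1 \<le> L\<close>, is attained
  and so stays strictly below 1.\<close>

lemma contractive_ifs_ifs_alpha: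
  assumes "complete X" "X \<noteq> {}" "ifs X L \<phi>"
    and "\<And>j. j \<in> {1..L} \<Longrightarrow> banach_contraction X (\<phi> j)"
  shows "contractive_ifs X L \<phi> (ifs_alpha X L \<phi>)"
proof
  show L: "1 \<le> L"
    using assms(3) by (simp add: ifs_def)
  then show "ifs_alpha X L \<phi> < 1"
    using assms(4) by (auto simp: ifs_alpha_def banach_contraction_def)
  fix j
  assume j: "j \<in> {1..L}"
  show "\<phi> j \<in> X \<rightarrow> X"
    using assms(3) j by (simp add: ifs_def)
  have "(Lip X (\<phi> j))-lipschitz_on X (\<phi> j)"
    using assms(4)[OF j] lipschitz_on_Lip by (auto simp: banach_contraction_def)
  moreover have "Lip X (\<phi> j) \<le> ifs_alpha X L \<phi>"
    unfolding ifs_alpha_def using j by (intro Max_ge) auto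
  ultimately show "(ifs_alpha X L \<phi>)-lipschitz_on X (\<phi> j)"
    using lipschitz_on_mono by blast
qed (use assms in auto)

theorem theorem6p2:
  fixes X Xhat :: "'a::metric_space set"
    and L :: nat and \<phi> :: "nat \<Rightarrow> 'a \<Rightarrow> 'a"
    and r :: "'a \<Rightarrow> 'a" and \<epsilon> :: real and K :: "'a set"
  assumes "complete X"
    and "ifs X L \<phi>"
    and "\<And>j. j \<in> {1..L} \<Longrightarrow> banach_contraction X (\<phi> j)"
    and "\<epsilon> > 0"
    and "eps_net X \<epsilon> Xhat" and "proper_in X Xhat"
    and "eps_projection X \<epsilon> Xhat r"
    and "K \<in> kstar Xhat"
  shows "(\<forall>n::nat.
            hausdorff_dist ((hutchinson L (discretized_maps Xhat r \<phi>) ^^ n) K) (attractor X L \<phi>)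
              \<le> 5 * \<epsilon> / (1 - ifs_alpha X L \<phi>)
                 + ifs_alpha X L \<phi> ^ n * hausdorff_dist K (attractor X L \<phi>))
       \<and> (\<exists>n0::nat. \<forall>n\<ge>n0.
            attractor_with_resolution X L \<phi> (6 * \<epsilon> / (1 - ifs_alpha X L \<phi>))
              ((hutchinson L (discretized_maps Xhat r \<phi>) ^^ n) K))"
proof -
  let ?a = "ifs_alpha X L \<phi>" and ?A = "attractor X L \<phi>"
    and ?K = "\<lambda>n. (hutchinson L (discretized_maps Xhat r \<phi>) ^^ n) K"
  have Y: "Xhat \<subseteq> X"
    using assms(5) by (simp add: eps_net_def)
  \<comment> \<open>Completeness does not exclude an empty \<open>X\<close>; a point of
    \<open>K\<close> does.\<close>
  moreover have "K \<noteq> {}" "K \<subseteq> Xhat"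
    using assms(8) by (auto simp: kstar_def)
  ultimately have "X \<noteq> {}"
    by auto
  interpret contractive_ifs X L \<phi> ?a
    by (rule contractive_ifs_ifs_alpha[OF assms(1) \<open>X \<noteq> {}\<close> assms(2,3)])
  note iterates = hausdorff_dist_discretized_iterates[OF assms(6) Y assms(7,8) less_imp_le[OF assms(4)]]
  have pos: "0 < \<epsilon> / (1 - ?a)"
    using assms(4) a by simp
  \<comment> \<open>The locale gives this with \<open>\<epsilon>\<close> in place of
    \<open>5 * \<epsilon>\<close>; positivity of \<open>\<epsilon> / (1 - ?a)\<close> weakens it to
    the stated constant.\<close>
  have bound: "hausdorff_dist (?K n) ?A \<le> 5 * \<epsilon> / (1 - ?a) + ?a ^ n * hausdorff_dist K ?A" for n
    using iterates(2)[of n] pos by (simp flip: times_divide_eq_right)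
  have "(\<lambda>n. ?a ^ n * hausdorff_dist K ?A) \<longlonglongrightarrow> 0 * hausdorff_dist K ?A"
    using a_nonneg a by (intro tendsto_mult LIMSEQ_realpow_zero tendsto_const)
  \<comment> \<open>Once the geometric term is below one further
    \<open>\<epsilon> / (1 - ?a)\<close>, the constants add up as 5 + 1 = 6.\<close>
  then have "\<forall>\<^sub>F n in sequentially. ?a ^ n * hausdorff_dist K ?A < \<epsilon> / (1 - ?a)"
    using pos by (intro order_tendstoD(2)) auto
  then obtain n0 where n0: "\<And>n. n \<ge> n0 \<Longrightarrow> ?a ^ n * hausdorff_dist K ?A < \<epsilon> / (1 - ?a)"
    by (auto simp: eventually_sequentially)
  have "attractor_with_resolution X L \<phi> (6 * \<epsilon> / (1 - ?a)) (?K n)" if "n \<ge> n0" for n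
    using iterates(1)[of n] bound[of n] n0[OF that]
    by (simp add: attractor_with_resolution_def flip: times_divide_eq_right)
  with bound show ?thesis
    by blast
qed

end
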